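(* Let $S_0>0$, $r\in\mathbb{R}$, $T>0$, $H\in(3/4,1]$, $(\sigma,\epsilon)\in\mathbb{R}^2\setminus\{(0,0)\}$, $\lambda>0$, $\mu_1\in\mathbb{R}$ and $\sigma_1^2>0$. On a probability space $(\Omega,\mathcal F,P)$ let $(W_t)_{t\ge0}$ be a standard Brownian motion, $(W^H_t)_{t\ge0}$ a standard fractional Brownian motion with Hurst index $H$, $(N(t))_{t\ge0}$ a Poisson process with rate $\lambda$, and $(J_i)_{i\ge1}$ an i.i.d. sequence of log-normal random variables with parameters $\mu_1,\sigma_1^2$ (i.e. $\log J_i$ is Gaussian with mean $\mu_1$ and variance $\sigma_1^2$), all of these being mutually independent. Put $$S_T=S_0\exp\Big(rT+\sigma W_T+\epsilon W^H_T-\tfrac12\sigma^2T-\tfrac12\epsilon^2T^{2H}\Big)\prod_{i=1}^{N(T)}J_i,$$ where the empty product is $1$. Then for every $x>0$ the distribution function $F_{S_T}(x)=P(S_T\le x)$ is $$F_{S_T}(x)=\sum_{n=0}^\infty \Phi\!\left(\frac{\log x-\log S_0-\big(rT-\frac12\sigma^2T-\frac12\epsilon^2T^{2H}+n\mu_1\big)}{\sqrt{\sigma^2T+\epsilon^2T^{2H}+n\sigma_1^2}}\right)e^{-\lambda T}\frac{(\lambda T)^n}{n!},$$ where $\Phi$ is the standard normal distribution function.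
   Context: A standard fractional Brownian motion with Hurst index $H\in(0,1]$ is an almost surely continuous centered Gaussian process $(W^H_t)$ with $\mathrm{Cov}(W^H_t,W^H_s)=\frac12(|t|^{2H}+|s|^{2H}-|t-s|^{2H})$. *)

theory Defs
  imports "HOL-Probability.Probability"
begin

text \<open>
  The Gaussian law on the reals with mean \<open>m\<close> and variance \<open>v \<ge> 0\<close>. A Gaussian process may have
  degenerate marginals (such as the value at time 0), so \<open>v = 0\<close> has to give the point mass.
\<close>
definition normal_measure :: "real \<Rightarrow> real \<Rightarrow> real measure" where
  "normal_measure m v =
     (if v = 0 then return borel m else density lborel (normal_density m (sqrt v)))"

definition std_normal_cdf :: "real \<Rightarrow> real" where
  "std_normal_cdf = cdf std_normal_distribution"

text \<open>The \<open>\<sigma>\<close>-algebra on the sample space generated by the family \<open>X t\<close> for \<open>t \<in> I\<close>.\<close>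
definition generated_events ::
    "'w measure \<Rightarrow> 'b measure \<Rightarrow> 'i set \<Rightarrow> ('i \<Rightarrow> 'w \<Rightarrow> 'b) \<Rightarrow> 'w set set" where
  "generated_events M N I X =
     sigma_sets (space M) {X t -` A \<inter> space M | t A. t \<in> I \<and> A \<in> sets N}"

context prob_space
begin

definition covariance :: "('a \<Rightarrow> real) \<Rightarrow> ('a \<Rightarrow> real) \<Rightarrow> real" where
  "covariance X Y = expectation (\<lambda>\<omega>. (X \<omega> - expectation X) * (Y \<omega> - expectation Y))"

definition gaussian_rv :: "('a \<Rightarrow> real) \<Rightarrow> bool" where
  "gaussian_rv X \<longleftrightarrow>
     random_variable borel X \<and> (\<exists>m v. 0 \<le> v \<and> distr M borel X = normal_measure m v)"

definition gaussian_process :: "'i set \<Rightarrow> ('i \<Rightarrow> 'a \<Rightarrow> real) \<Rightarrow> bool" where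
  "gaussian_process I X \<longleftrightarrow>
     (\<forall>F c. finite F \<and> F \<subseteq> I \<longrightarrow> gaussian_rv (\<lambda>\<omega>. \<Sum>t\<in>F. c t * X t \<omega>))"

definition fractional_brownian_motion :: "real \<Rightarrow> (real \<Rightarrow> 'a \<Rightarrow> real) \<Rightarrow> bool" where
  "fractional_brownian_motion H X \<longleftrightarrow>
     0 < H \<and> H \<le> 1 \<and>
     gaussian_process {0..} X \<and>
     (\<forall>t\<ge>0. expectation (X t) = 0) \<and>
     (\<forall>s\<ge>0. \<forall>t\<ge>0. covariance (X t) (X s) =
        1 / 2 * (\<bar>t\<bar> powr (2 * H) + \<bar>s\<bar> powr (2 * H) - \<bar>t - s\<bar> powr (2 * H))) \<and>
     (AE \<omega> in M. continuous_on {0..} (\<lambda>t. X t \<omega>))"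

definition indep_increments :: "(real \<Rightarrow> 'a \<Rightarrow> real) \<Rightarrow> bool" where
  "indep_increments X \<longleftrightarrow>
     (\<forall>(t :: nat \<Rightarrow> real) n. 0 \<le> t 0 \<and> mono_on {..n} t \<longrightarrow>
        indep_vars (\<lambda>_. borel) (\<lambda>i \<omega>. X (t (Suc i)) \<omega> - X (t i) \<omega>) {..<n})"

definition brownian_motion :: "(real \<Rightarrow> 'a \<Rightarrow> real) \<Rightarrow> bool" where
  "brownian_motion X \<longleftrightarrow>
     (\<forall>t\<ge>0. random_variable borel (X t)) \<and>
     (AE \<omega> in M. X 0 \<omega> = 0) \<and>
     indep_increments X \<and>
     (\<forall>s\<ge>0. \<forall>t>s. distr M borel (\<lambda>\<omega>. X t \<omega> - X s \<omega>) = normal_measure 0 (t - s)) \<and>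
     (AE \<omega> in M. continuous_on {0..} (\<lambda>t. X t \<omega>))"

text \<open>Increments are formed in the reals because subtraction on \<^typ>\<open>nat\<close> truncates.\<close>
definition poisson_process :: "real \<Rightarrow> (real \<Rightarrow> 'a \<Rightarrow> nat) \<Rightarrow> bool" where
  "poisson_process rate X \<longleftrightarrow>
     0 < rate \<and>
     (\<forall>t\<ge>0. random_variable (count_space UNIV) (X t)) \<and>
     (AE \<omega> in M. X 0 \<omega> = 0) \<and>
     indep_increments (\<lambda>t \<omega>. real (X t \<omega>)) \<and>
     (\<forall>s\<ge>0. \<forall>t>s. distr M borel (\<lambda>\<omega>. real (X t \<omega>) - real (X s \<omega>)) =
        distr (measure_pmf (poisson_pmf (rate * (t - s)))) borel real) \<and>
     (AE \<omega> in M. mono_on {0..} (\<lambda>t. X t \<omega>) \<and>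
        (\<forall>t\<ge>0. continuous (at_right t) (\<lambda>s. real (X s \<omega>))))"

definition lognormal_rv :: "real \<Rightarrow> real \<Rightarrow> ('a \<Rightarrow> real) \<Rightarrow> bool" where
  "lognormal_rv m v X \<longleftrightarrow>
     random_variable borel X \<and> (AE \<omega> in M. 0 < X \<omega>) \<and>
     distr M borel (\<lambda>\<omega>. ln (X \<omega>)) = normal_measure m v"

end

text \<open>The terminal price of the mixed fractional jump model; \<open>\<epsilon>\<close> is the volatility of the fractional part.\<close>
definition terminal_price ::
    "real \<Rightarrow> real \<Rightarrow> real \<Rightarrow> real \<Rightarrow> real \<Rightarrow> real \<Rightarrow> (real \<Rightarrow> 'w \<Rightarrow> real) \<Rightarrow> (real \<Rightarrow> 'w \<Rightarrow> real) \<Rightarrow>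
     (real \<Rightarrow> 'w \<Rightarrow> nat) \<Rightarrow> (nat \<Rightarrow> 'w \<Rightarrow> real) \<Rightarrow> 'w \<Rightarrow> real" where
  "terminal_price S0 r T H \<sigma> \<epsilon> W WH N J \<omega> =
     S0 * exp (r * T + \<sigma> * W T \<omega> + \<epsilon> * WH T \<omega>
               - 1 / 2 * \<sigma>\<^sup>2 * T - 1 / 2 * \<epsilon>\<^sup>2 * T powr (2 * H))
        * (\<Prod>i = 1..N T \<omega>. J i \<omega>)"

end

(* On N T = n the log-price is, up to a constant, the independent sum
   sigma * W T + eps * WH T + ln J_1 + ... + ln J_n, which is Gaussian and independent of N T.
   Summing over the values of N T turns the distribution function into a Poisson mixture of
   Gaussian ones.  Some summands may be degenerate (sigma = 0, eps = 0 or n = 0), so closure of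
   Gaussian laws under affine maps and independent sums has to include variance 0. *)

theory Submission
  imports Defs
begin

lemma sets_normal_measure [simp, measurable_cong]: "sets (normal_measure m v) = sets borel"
  by (simp add: normal_measure_def)

section \<open>Sigma-algebras generated by a family of random variables\<close>

lemma sets_generated_events:
  "sets (sigma (space M) {X t -` A \<inter> space M | t A. t \<in> I \<and> A \<in> sets N}) = generated_events M N I X"
  unfolding generated_events_def by (rule sets_measure_of) auto

lemma measurable_generated_events:
  assumes "t \<in> I" and "\<And>\<omega>. \<omega> \<in> space M \<Longrightarrow> X t \<omega> \<in> space N"
  shows "X t \<in> measurable (sigma (space M) {X t -` A \<inter> space M | t A. t \<in> I \<and> A \<in> sets N}) N"
    (is "_ \<in> measurable ?G N")
proof (rule measurableI)
  fix A assume "A \<in> sets N"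
  then show "X t -` A \<inter> space ?G \<in> sets ?G"
    using assms(1) unfolding sets_generated_events generated_events_def
    by (auto simp: space_measure_of_conv)
qed (use assms(2) in \<open>simp add: space_measure_of_conv\<close>)

text \<open>Independence is assumed for set systems of the form \<open>generated_events\<close>.
  Functions of a family, such as sums of logarithms, are easier to treat by closure rules for
  measurable maps; this lemma carries the result back to the set system.\<close>

lemma vimage_in_generated_events:
  assumes "Y \<in> measurable (sigma (space M) {X t -` A \<inter> space M | t A. t \<in> I \<and> A \<in> sets N}) L"
    and "B \<in> sets L"
  shows "Y -` B \<inter> space M \<in> generated_events M N I X"
  using measurable_sets[OF assms] by (simp add: sets_generated_events space_measure_of_conv)

section \<open>Gaussian laws, variance 0 included\<close>

context prob_space
begin

text \<open>Gives access to the density calculus of \<open>distributed\<close> when the variance is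
  positive. The reference measure \<open>lborel\<close> has the same sets as \<open>borel\<close>,
  so the image measure does not change.\<close>

lemma distr_eq_normal_measure_iff:
  assumes "random_variable borel X" and "0 < v"
  shows "distr M borel X = normal_measure m v \<longleftrightarrow> distributed M lborel X (normal_density m (sqrt v))"
proof -
  have "distr M lborel X = distr M borel X"
    by (rule distr_cong) auto
  then show ?thesis
    using assms by (simp add: normal_measure_def distributed_def)
qed

text \<open>Counterpart for variance 0: under a point mass the variable is almost surely constant,
  so it may be replaced by that constant in any law.\<close>

lemma distr_eq_return_iff:
  fixes X :: "'a \<Rightarrow> real"
  assumes [measurable]: "random_variable borel X"
  shows "distr M borel X = return borel c \<longleftrightarrow> (AE \<omega> in M. X \<omega> = c)"
proof
  assume D: "distr M borel X = return borel c"
  have "AE y in return borel c. y = c"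
    by (subst AE_return) auto
  then have "AE y in distr M borel X. y = c"
    unfolding D .
  then show "AE \<omega> in M. X \<omega> = c"
    by (subst (asm) AE_distr_iff) auto
next
  assume "AE \<omega> in M. X \<omega> = c"
  then have "distr M borel X = distr M borel (\<lambda>_. c)"
    by (intro distr_cong_AE) auto
  also have "\<dots> = return borel c"
    by (rule distr_const) simp
  finally show "distr M borel X = return borel c" .
qed

text \<open>If \<open>v = 0\<close> or \<open>a = 0\<close>, the image is almost surely the constant
  \<open>b + a * m\<close>. Otherwise it has a density with standard deviation
  \<open>\<bar>a\<bar> * sqrt v\<close>, the absolute value covering negative slopes.\<close>

lemma normal_measure_affine:
  assumes X [measurable]: "random_variable borel X"
    and D: "distr M borel X = normal_measure m v" and "0 \<le> v"
  shows "distr M borel (\<lambda>\<omega>. b + a * X \<omega>) = normal_measure (b + a * m) (a\<^sup>2 * v)"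
proof (cases "v = 0 \<or> a = 0")
  case True
  then have "AE \<omega> in M. b + a * X \<omega> = b + a * m"
    using D distr_eq_return_iff[OF X, of m] by (auto simp: normal_measure_def)
  then show ?thesis
    using True by (subst normal_measure_def) (auto simp: distr_eq_return_iff)
next
  case False
  then have v: "0 < v" and a: "a \<noteq> 0"
    using \<open>0 \<le> v\<close> by auto
  have "distributed M lborel (\<lambda>\<omega>. b + a * X \<omega>) (normal_density (b + a * m) (\<bar>a\<bar> * sqrt v))"
    using D v a by (intro normal_density_affine) (simp_all add: distr_eq_normal_measure_iff)
  moreover have "\<bar>a\<bar> * sqrt v = sqrt (a\<^sup>2 * v)"
    by (simp add: real_sqrt_mult)
  ultimately show ?thesis
    using v a by (simp add: distr_eq_normal_measure_iff)
qed

text \<open>A summand of variance 0 is almost surely constant, so it only shifts the other one,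
  which is the affine case with slope 1. The convolution of normal densities is needed only when
  both variances are positive.\<close>

lemma normal_measure_add:
  assumes ind: "indep_var borel X borel Y"
    and X: "distr M borel X = normal_measure m v" and Y: "distr M borel Y = normal_measure m' v'"
    and "0 \<le> v" and "0 \<le> v'"
  shows "distr M borel (\<lambda>\<omega>. X \<omega> + Y \<omega>) = normal_measure (m + m') (v + v')"
proof -
  have [measurable]: "random_variable borel X" "random_variable borel Y"
    using ind by (auto dest: indep_var_rv1 indep_var_rv2)
  consider "v = 0" | "v' = 0" | "0 < v" "0 < v'"
    using assms by fastforce
  then show ?thesis
  proof cases
    case 1
    then have "AE \<omega> in M. X \<omega> = m"
      using X by (simp add: normal_measure_def distr_eq_return_iff)
    then have "distr M borel (\<lambda>\<omega>. X \<omega> + Y \<omega>) = distr M borel (\<lambda>\<omega>. m + 1 * Y \<omega>)"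
      by (intro distr_cong_AE) auto
    then show ?thesis
      using 1 normal_measure_affine[OF _ Y \<open>0 \<le> v'\<close>, of m 1] by simp
  next
    case 2
    then have "AE \<omega> in M. Y \<omega> = m'"
      using Y by (simp add: normal_measure_def distr_eq_return_iff)
    then have "distr M borel (\<lambda>\<omega>. X \<omega> + Y \<omega>) = distr M borel (\<lambda>\<omega>. m' + 1 * X \<omega>)"
      by (intro distr_cong_AE) auto
    then show ?thesis
      using 2 normal_measure_affine[OF _ X \<open>0 \<le> v\<close>, of m' 1] by (simp add: add.commute)
  next
    case 3
    then have "distributed M lborel (\<lambda>\<omega>. X \<omega> + Y \<omega>) (normal_density (m + m') (sqrt ((sqrt v)\<^sup>2 + (sqrt v')\<^sup>2)))"
      using X Y ind by (intro add_indep_normal) (simp_all add: distr_eq_normal_measure_iff)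
    then show ?thesis
      using 3 by (simp add: distr_eq_normal_measure_iff)
  qed
qed

lemma normal_measure_sum:
  assumes "finite I" and "indep_vars (\<lambda>_. borel) X I"
    and "\<And>i. i \<in> I \<Longrightarrow> distr M borel (X i) = normal_measure (m i) (v i)"
    and "\<And>i. i \<in> I \<Longrightarrow> 0 \<le> v i"
  shows "distr M borel (\<lambda>\<omega>. \<Sum>i\<in>I. X i \<omega>) = normal_measure (\<Sum>i\<in>I. m i) (\<Sum>i\<in>I. v i)"
  using assms
proof (induction I rule: finite_induct)
  case empty
  \<comment> \<open>The empty sum is the constant 0, that is \<open>normal_measure 0 0\<close>. This
    is the law of the jump part when no jump occurs.\<close>
  show ?case
    by (simp add: normal_measure_def distr_eq_return_iff)
next
  case (insert i I)
  have "distr M borel (\<lambda>\<omega>. \<Sum>i\<in>I. X i \<omega>) = normal_measure (\<Sum>i\<in>I. m i) (\<Sum>i\<in>I. v i)"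
    using insert.prems by (intro insert.IH) (auto intro: indep_vars_subset)
  then have "distr M borel (\<lambda>\<omega>. X i \<omega> + (\<Sum>i\<in>I. X i \<omega>)) =
      normal_measure (m i + (\<Sum>i\<in>I. m i)) (v i + (\<Sum>i\<in>I. v i))"
    using insert.hyps insert.prems by (intro normal_measure_add indep_vars_sum sum_nonneg) auto
  then show ?case
    using insert.hyps by simp
qed

text \<open>Standardisation: since \<open>sqrt v\<close> is positive, dividing by it preserves the
  inequality, and \<open>(X - m) / sqrt v\<close> is standard normal.\<close>

lemma prob_le_normal_measure:
  assumes [measurable]: "random_variable borel X"
    and D: "distr M borel X = normal_measure m v" and v: "0 < v"
  shows "prob {\<omega> \<in> space M. X \<omega> \<le> y} = std_normal_cdf ((y - m) / sqrt v)"
proof -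
  have "distributed M lborel (\<lambda>\<omega>. (X \<omega> - m) / sqrt v) std_normal_density"
    using D v by (simp add: distr_eq_normal_measure_iff normal_standard_normal_convert[symmetric])
  then have "distr M lborel (\<lambda>\<omega>. (X \<omega> - m) / sqrt v) = std_normal_distribution"
    by (simp add: distributed_def)
  then have "std_normal_cdf ((y - m) / sqrt v) =
      measure (distr M lborel (\<lambda>\<omega>. (X \<omega> - m) / sqrt v)) {..(y - m) / sqrt v}"
    by (simp add: std_normal_cdf_def cdf_def2)
  also have "\<dots> = prob {\<omega> \<in> space M. X \<omega> \<le> y}"
    using v by (subst measure_distr) (auto intro!: arg_cong[where f = prob] simp: field_simps)
  finally show ?thesis by simp
qed

text \<open>\<open>gaussian_rv\<close> only asserts that some parameters exist. This identifies them
  from the moments, which is how the mean and covariance of a Gaussian process fix its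
  marginals.\<close>

lemma normal_measure_expectation_variance:
  assumes [measurable]: "random_variable borel X"
    and D: "distr M borel X = normal_measure m v" and "0 \<le> v"
  shows "expectation X = m" and "variance X = v"
proof -
  have "expectation X = m \<and> variance X = v"
  proof (cases "v = 0")
    case True
    then have X: "AE \<omega> in M. X \<omega> = m"
      using D by (simp add: normal_measure_def distr_eq_return_iff)
    then have "expectation X = expectation (\<lambda>_. m)"
      by (intro integral_cong_AE) auto
    then have E: "expectation X = m"
      by (simp add: prob_space)
    have "variance X = expectation (\<lambda>_. 0)"
      using X by (intro integral_cong_AE) (auto simp: E)
    with E True show ?thesis by simp
  next
    case False
    then have "0 < v" using \<open>0 \<le> v\<close> by simp
    then have "distributed M lborel X (normal_density m (sqrt v))"
      using D by (simp add: distr_eq_normal_measure_iff)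
    with \<open>0 < v\<close> show ?thesis
      using normal_distributed_expectation[of "sqrt v" X m] normal_distributed_variance[of "sqrt v" X m]
      by simp
  qed
  then show "expectation X = m" "variance X = v" by auto
qed

section \<open>Laws of the driving processes at a fixed time\<close>

lemma fractional_brownian_motion_marginal:
  assumes X: "fractional_brownian_motion H X" and "0 \<le> t"
  shows "random_variable borel (X t)" and "distr M borel (X t) = normal_measure 0 (t powr (2 * H))"
proof -
  \<comment> \<open>A single marginal is the linear combination over \<open>{t}\<close> with
    coefficient 1.\<close>
  have "gaussian_rv (\<lambda>\<omega>. \<Sum>s\<in>{t}. 1 * X s \<omega>)"
    using X \<open>0 \<le> t\<close> unfolding fractional_brownian_motion_def gaussian_process_def
    by (elim conjE allE[where x = "{t}"] allE[where x = "\<lambda>_. 1"]) simp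
  then obtain m v where rv: "random_variable borel (X t)"
      and D: "0 \<le> v" "distr M borel (X t) = normal_measure m v"
    by (auto simp: gaussian_rv_def)
  have "expectation (X t) = 0"
    using X \<open>0 \<le> t\<close> by (simp add: fractional_brownian_motion_def)
  \<comment> \<open>On the diagonal the last term is a power of 0, hence 0, and half of the two
    equal terms leaves \<open>t powr (2 * H)\<close>.\<close>
  moreover have "covariance (X t) (X t) = 1 / 2 * (\<bar>t\<bar> powr (2 * H) + \<bar>t\<bar> powr (2 * H) - \<bar>t - t\<bar> powr (2 * H))"
    using X \<open>0 \<le> t\<close> unfolding fractional_brownian_motion_def by blast
  then have "covariance (X t) (X t) = t powr (2 * H)"
    using \<open>0 \<le> t\<close> by simp
  ultimately have "m = 0" "v = t powr (2 * H)"
    using normal_measure_expectation_variance[OF rv D(2,1)]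
    by (simp_all add: covariance_def power2_eq_square)
  with rv D show "random_variable borel (X t)" "distr M borel (X t) = normal_measure 0 (t powr (2 * H))"
    by auto
qed

text \<open>The definition prescribes only laws of increments. As \<open>X 0\<close> vanishes almost
  surely, the increment over the interval from 0 to \<open>t\<close> has the law of
  \<open>X t\<close>.\<close>

lemma brownian_motion_marginal:
  assumes X: "brownian_motion X" and "0 < t"
  shows "random_variable borel (X t)" and "distr M borel (X t) = normal_measure 0 t"
proof -
  have [measurable]: "random_variable borel (X t)" "random_variable borel (X 0)"
    using X \<open>0 < t\<close> by (auto simp: brownian_motion_def)
  show "random_variable borel (X t)" by fact
  have "AE \<omega> in M. X 0 \<omega> = 0" and inc: "distr M borel (\<lambda>\<omega>. X t \<omega> - X 0 \<omega>) = normal_measure 0 (t - 0)"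
    using X \<open>0 < t\<close> unfolding brownian_motion_def by blast+
  then have "distr M borel (X t) = distr M borel (\<lambda>\<omega>. X t \<omega> - X 0 \<omega>)"
    by (intro distr_cong_AE) auto
  with inc show "distr M borel (X t) = normal_measure 0 t" by simp
qed

lemma poisson_process_marginal:
  assumes X: "poisson_process l X" and "0 < t"
  shows "random_variable (count_space UNIV) (X t)"
    and "prob {\<omega> \<in> space M. X t \<omega> = n} = exp (- (l * t)) * ((l * t) ^ n / fact n)"
proof -
  have [measurable]: "random_variable (count_space UNIV) (X t)" "random_variable (count_space UNIV) (X 0)"
    using X \<open>0 < t\<close> by (auto simp: poisson_process_def)
  show "random_variable (count_space UNIV) (X t)" by fact
  have AE0: "AE \<omega> in M. X 0 \<omega> = 0" and l: "0 < l"
    and inc: "distr M borel (\<lambda>\<omega>. real (X t \<omega>) - real (X 0 \<omega>)) =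
      distr (measure_pmf (poisson_pmf (l * (t - 0)))) borel real"
    using X \<open>0 < t\<close> unfolding poisson_process_def by blast+
  have "distr M borel (\<lambda>\<omega>. real (X t \<omega>)) = distr M borel (\<lambda>\<omega>. real (X t \<omega>) - real (X 0 \<omega>))"
    using AE0 by (intro distr_cong_AE) auto
  with inc have D: "distr M borel (\<lambda>\<omega>. real (X t \<omega>)) = distr (measure_pmf (poisson_pmf (l * t))) borel real"
    by simp
  \<comment> \<open>The increment law is given on the reals. Since \<open>real\<close> is injective,
    the atom at \<open>real n\<close> pulls back to the single count \<open>n\<close> on both
    sides.\<close>
  have "prob {\<omega> \<in> space M. X t \<omega> = n} = measure (distr M borel (\<lambda>\<omega>. real (X t \<omega>))) {real n}"
    by (subst measure_distr) (auto intro!: arg_cong[where f = prob])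
  also have "\<dots> = measure (measure_pmf (poisson_pmf (l * t))) {n}"
    unfolding D by (subst measure_distr) (auto intro!: arg_cong[where f = "measure _"])
  also have "\<dots> = exp (- (l * t)) * ((l * t) ^ n / fact n)"
    using l \<open>0 < t\<close> by (simp add: measure_pmf_single)
  finally show "prob {\<omega> \<in> space M. X t \<omega> = n} = exp (- (l * t)) * ((l * t) ^ n / fact n)" .
qed

end

section \<open>Distribution function of the terminal price\<close>

theorem mainTheorem3:
  fixes M :: "'w measure"
    and W WH :: "real \<Rightarrow> 'w \<Rightarrow> real"
    and N :: "real \<Rightarrow> 'w \<Rightarrow> nat"
    and J :: "nat \<Rightarrow> 'w \<Rightarrow> real"
    and S0 r T H \<sigma> \<epsilon> rate \<mu>1 \<sigma>1 x :: real
  assumes "S0 > 0" and "T > 0" and "3 / 4 < H" and "H \<le> 1"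
    and "(\<sigma>, \<epsilon>) \<noteq> (0, 0)" and "rate > 0" and "\<sigma>1\<^sup>2 > 0"
    and "prob_space M"
    and "prob_space.brownian_motion M W"
    and "prob_space.fractional_brownian_motion M H WH"
    and "prob_space.poisson_process M rate N"
    and "prob_space.indep_vars M (\<lambda>_. borel) J {1..}"
    and "\<And>i. i \<ge> 1 \<Longrightarrow> prob_space.lognormal_rv M \<mu>1 (\<sigma>1\<^sup>2) (J i)"
    and "prob_space.indep_sets M
           (\<lambda>k. [generated_events M borel {0..} W,
                 generated_events M borel {0..} WH,
                 generated_events M (count_space UNIV) {0..} N,
                 generated_events M borel {1..} J] ! k) {..<4}"
    and "x > 0"
  shows "(\<lambda>n. std_normal_cdf
                ((ln x - ln S0
                    - (r * T - 1 / 2 * \<sigma>\<^sup>2 * T - 1 / 2 * \<epsilon>\<^sup>2 * T powr (2 * H) + real n * \<mu>1))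
                  / sqrt (\<sigma>\<^sup>2 * T + \<epsilon>\<^sup>2 * T powr (2 * H) + real n * \<sigma>1\<^sup>2))
              * exp (- (rate * T)) * ((rate * T) ^ n / fact n))
         sums measure M {\<omega> \<in> space M. terminal_price S0 r T H \<sigma> \<epsilon> W WH N J \<omega> \<le> x}"
proof -
  interpret prob_space M by fact
  define gens where "gens = [generated_events M borel {0..} W, generated_events M borel {0..} WH,
    generated_events M (count_space UNIV) {0..} N, generated_events M borel {1..} J]"
  define a where "a = r * T - 1 / 2 * \<sigma>\<^sup>2 * T - 1 / 2 * \<epsilon>\<^sup>2 * T powr (2 * H)"
  \<comment> \<open>One variable per source of randomness, in the same order as \<open>gens\<close>,
    with the number of jumps frozen at \<open>n\<close>. Index 2 is the Poisson count, so the
    log-price collects indices 0, 1 and 3. The deterministic part of the log-return is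
    \<open>a\<close>.\<close>
  define L where "L n k = [\<lambda>\<omega>. \<sigma> * W T \<omega>, \<lambda>\<omega>. \<epsilon> * WH T \<omega>, \<lambda>\<omega>. real (N T \<omega>),
    \<lambda>\<omega>. \<Sum>i=1..n. ln (J i \<omega>)] ! k" for n k
  define logS where "logS n \<omega> = (\<Sum>k\<in>{0,1,3}. L n k \<omega>)" for n \<omega>
  define E where "E n = {\<omega> \<in> space M. N T \<omega> = n \<and> terminal_price S0 r T H \<sigma> \<epsilon> W WH N J \<omega> \<le> x}" for n

  note W = brownian_motion_marginal[OF \<open>brownian_motion W\<close> \<open>0 < T\<close>]
  have WH: "random_variable borel (WH T)" "distr M borel (WH T) = normal_measure 0 (T powr (2 * H))"
    using fractional_brownian_motion_marginal[OF \<open>fractional_brownian_motion H WH\<close>, of T] \<open>0 < T\<close> by auto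
  note N = poisson_process_marginal[OF \<open>poisson_process rate N\<close> \<open>0 < T\<close>]
  have J: "random_variable borel (J i)" "AE \<omega> in M. 0 < J i \<omega>"
      "distr M borel (\<lambda>\<omega>. ln (J i \<omega>)) = normal_measure \<mu>1 (\<sigma>1\<^sup>2)" if "i \<ge> 1" for i
    using assms(13)[OF that] by (auto simp: lognormal_rv_def)
  note [measurable] = W(1) WH(1) N(1)

  have L_meas [measurable]: "random_variable borel (L n k)" if "k < 4" for n k
  proof -
    have "random_variable borel (\<lambda>\<omega>. \<Sum>i=1..n. ln (J i \<omega>))"
      by (intro borel_measurable_sum borel_measurable_ln J) auto
    moreover from that have "k \<in> {0, 1, 2, 3}" by auto
    ultimately show ?thesis by (auto simp: L_def)
  qed
  have logS_meas [measurable]: "random_variable borel (logS n)" for n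
    unfolding logS_def by (intro borel_measurable_sum L_meas) auto

  \<comment> \<open>Each \<open>L n k\<close> is a function of the k-th source alone, so its events
    lie in \<open>gens ! k\<close>, and independence passes to smaller set systems.\<close>
  have indep_L: "indep_vars (\<lambda>_. borel) (L n) {..<4}" for n
    unfolding indep_vars_def2
  proof (intro conjI ballI)
    show "indep_sets (\<lambda>k. {L n k -` A \<inter> space M | A. A \<in> sets borel}) {..<4}"
    proof (rule indep_sets_mono_sets)
      show "indep_sets (\<lambda>k. gens ! k) {..<4}"
        using assms(14) by (simp add: gens_def)
      fix k :: nat assume "k \<in> {..<4}"
      then consider "k = 0" | "k = 1" | "k = 2" | "k = 3" by force
      then show "{L n k -` A \<inter> space M | A. A \<in> sets borel} \<subseteq> gens ! k"
      proof cases
        case 1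
        have "W T \<in> borel_measurable (sigma (space M) {W t -` A \<inter> space M | t A. t \<in> {0..} \<and> A \<in> sets borel})"
          using \<open>0 < T\<close> by (intro measurable_generated_events) auto
        then have "L n k \<in> borel_measurable (sigma (space M) {W t -` A \<inter> space M | t A. t \<in> {0..} \<and> A \<in> sets borel})"
          using 1 by (simp add: L_def)
        from vimage_in_generated_events[OF this] 1 show ?thesis by (auto simp: gens_def)
      next
        case 2
        have "WH T \<in> borel_measurable (sigma (space M) {WH t -` A \<inter> space M | t A. t \<in> {0..} \<and> A \<in> sets borel})"
          using \<open>0 < T\<close> by (intro measurable_generated_events) auto
        then have "L n k \<in> borel_measurable (sigma (space M) {WH t -` A \<inter> space M | t A. t \<in> {0..} \<and> A \<in> sets borel})"
          using 2 by (simp add: L_def)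
        from vimage_in_generated_events[OF this] 2 show ?thesis by (auto simp: gens_def)
      next
        case 3
        have "N T \<in> measurable (sigma (space M) {N t -` A \<inter> space M | t A. t \<in> {0..} \<and> A \<in> sets (count_space UNIV)})
            (count_space UNIV)"
          using \<open>0 < T\<close> by (intro measurable_generated_events) auto
        then have "L n k \<in> borel_measurable
            (sigma (space M) {N t -` A \<inter> space M | t A. t \<in> {0..} \<and> A \<in> sets (count_space UNIV)})"
          using 3 by (auto simp: L_def intro: measurable_compose)
        from vimage_in_generated_events[OF this] 3 show ?thesis by (auto simp: gens_def)
      next
        case 4
        have "J i \<in> borel_measurable (sigma (space M) {J t -` A \<inter> space M | t A. t \<in> {1..} \<and> A \<in> sets borel})" if "i \<in> {1..n}" for i
          using that by (intro measurable_generated_events) auto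
        then have "(\<lambda>\<omega>. \<Sum>i=1..n. ln (J i \<omega>)) \<in> borel_measurable (sigma (space M) {J t -` A \<inter> space M | t A. t \<in> {1..} \<and> A \<in> sets borel})"
          by (intro borel_measurable_sum borel_measurable_ln)
        then have "L n k \<in> borel_measurable (sigma (space M) {J t -` A \<inter> space M | t A. t \<in> {1..} \<and> A \<in> sets borel})"
          using 4 by (simp add: L_def)
        from vimage_in_generated_events[OF this] 4 show ?thesis by (auto simp: gens_def)
      qed
    qed
  qed simp

  have logS_distr: "distr M borel (logS n) =
      normal_measure (real n * \<mu>1) (\<sigma>\<^sup>2 * T + \<epsilon>\<^sup>2 * T powr (2 * H) + real n * \<sigma>1\<^sup>2)" for n
  proof -
    \<comment> \<open>Both noise terms are centered; \<open>n\<close> log-jumps contribute mean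
      \<open>real n * \<mu>1\<close> and variance \<open>real n * \<sigma>1\<^sup>2\<close>.\<close>
    define m where "m k = (if k = 3 then real n * \<mu>1 else 0)" for k :: nat
    define v where "v k = [\<sigma>\<^sup>2 * T, \<epsilon>\<^sup>2 * T powr (2 * H), 0, real n * \<sigma>1\<^sup>2] ! k" for k :: nat
    \<comment> \<open>Two levels of independence enter: among the jumps for the inner sum, and
      across the sources (\<open>indep_L\<close>) for the sum of the three terms.\<close>
    have "indep_vars (\<lambda>_. borel) (\<lambda>i \<omega>. ln (J i \<omega>)) {1..n}"
      by (rule indep_vars_compose2[OF indep_vars_subset[OF assms(12)]]) auto
    then have "distr M borel (\<lambda>\<omega>. \<Sum>i=1..n. ln (J i \<omega>)) = normal_measure (\<Sum>i=1..n. \<mu>1) (\<Sum>i=1..n. \<sigma>1\<^sup>2)"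
      by (intro normal_measure_sum J) auto
    then have "distr M borel (L n k) = normal_measure (m k) (v k)" if "k \<in> {0, 1, 3}" for k
      using that normal_measure_affine[OF W, of 0 \<sigma>] normal_measure_affine[OF WH, of 0 \<epsilon>] \<open>0 < T\<close>
      by (auto simp: L_def m_def v_def)
    moreover have "0 \<le> v k" if "k \<in> {0, 1, 3}" for k
      using that \<open>0 < T\<close> by (auto simp: v_def)
    moreover have "indep_vars (\<lambda>_. borel) (L n) {0, 1, 3}"
      by (rule indep_vars_subset[OF indep_L]) auto
    ultimately have "distr M borel (\<lambda>\<omega>. \<Sum>k\<in>{0, 1, 3}. L n k \<omega>) =
        normal_measure (\<Sum>k\<in>{0, 1, 3}. m k) (\<Sum>k\<in>{0, 1, 3}. v k)"
      by (intro normal_measure_sum) auto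
    then show ?thesis
      by (simp add: logS_def[abs_def] m_def v_def add.assoc)
  qed

  have indep_N: "indep_var borel (\<lambda>\<omega>. real (N T \<omega>)) borel (logS n)" for n
  proof -
    \<comment> \<open>Splitting off index 2 makes the Poisson count independent of the sum of the
      remaining variables.\<close>
    have "insert 2 {0, 1, 3} = {..<4::nat}" by auto
    then have "indep_var borel (L n 2) borel (logS n)"
      unfolding logS_def[abs_def] using indep_L by (intro indep_vars_sum) auto
    then show ?thesis by (simp add: L_def)
  qed

  have price_iff: "AE \<omega> in M. terminal_price S0 r T H \<sigma> \<epsilon> W WH N J \<omega> \<le> x \<longleftrightarrow>
      logS (N T \<omega>) \<omega> \<le> ln x - ln S0 - a"
  proof -
    \<comment> \<open>Positivity must hold for all \<open>i\<close> at once because the number of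
      factors \<open>N T \<omega>\<close> is random; countability of the index set gives a common
      null set. The product then becomes the exponential of a sum of logarithms.\<close>
    have "AE \<omega> in M. \<forall>i\<in>{1..}. 0 < J i \<omega>"
      using J(2) by (subst AE_ball_countable) auto
    then show ?thesis
    proof eventually_elim
      case (elim \<omega>)
      let ?P = "\<Prod>i=1..N T \<omega>. J i \<omega>"
      have J_pos: "0 < J i \<omega>" if "1 \<le> i" for i
        using elim that by simp
      have P: "?P = exp (\<Sum>i=1..N T \<omega>. ln (J i \<omega>))"
        using J_pos by (simp add: exp_sum)
      have "terminal_price S0 r T H \<sigma> \<epsilon> W WH N J \<omega> = S0 * exp (a + \<sigma> * W T \<omega> + \<epsilon> * WH T \<omega>) * ?P"
        by (simp add: terminal_price_def a_def algebra_simps)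
      also have "\<dots> = exp (ln S0 + a + logS (N T \<omega>) \<omega>)"
        unfolding P using \<open>0 < S0\<close> by (simp add: logS_def L_def exp_add)
      finally show ?case
        using ln_ge_iff[OF \<open>0 < x\<close>] by (simp add: algebra_simps)
    qed
  qed

  have E_meas: "E n \<in> events" for n
  proof -
    \<comment> \<open>On \<open>N T \<omega> = n\<close> the random number of factors may be
      replaced by the fixed \<open>n\<close>, which leaves a finite product of measurable
      functions.\<close>
    have [measurable]: "random_variable borel (\<lambda>\<omega>. \<Prod>i=1..n. J i \<omega>)"
      by (intro borel_measurable_prod J) auto
    have "{\<omega> \<in> space M. N T \<omega> = n \<and> S0 * exp (r * T + \<sigma> * W T \<omega> + \<epsilon> * WH T \<omega>
        - 1 / 2 * \<sigma>\<^sup>2 * T - 1 / 2 * \<epsilon>\<^sup>2 * T powr (2 * H)) * (\<Prod>i=1..n. J i \<omega>) \<le> x} \<in> events"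
      by measurable
    also have "{\<omega> \<in> space M. N T \<omega> = n \<and> S0 * exp (r * T + \<sigma> * W T \<omega> + \<epsilon> * WH T \<omega>
        - 1 / 2 * \<sigma>\<^sup>2 * T - 1 / 2 * \<epsilon>\<^sup>2 * T powr (2 * H)) * (\<Prod>i=1..n. J i \<omega>) \<le> x} = E n"
      by (auto simp: E_def terminal_price_def)
    finally show ?thesis .
  qed

  have prob_E: "prob (E n) = std_normal_cdf ((ln x - ln S0 - (a + real n * \<mu>1))
        / sqrt (\<sigma>\<^sup>2 * T + \<epsilon>\<^sup>2 * T powr (2 * H) + real n * \<sigma>1\<^sup>2))
      * exp (- (rate * T)) * ((rate * T) ^ n / fact n)" for n
  proof -
    \<comment> \<open>At least one volatility is nonzero, so the variance is positive even for
      \<open>n = 0\<close> and standardisation applies to every term of the series.\<close>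
    have "0 < \<sigma>\<^sup>2 * T \<or> 0 < \<epsilon>\<^sup>2 * T powr (2 * H)"
      using \<open>(\<sigma>, \<epsilon>) \<noteq> (0, 0)\<close> \<open>0 < T\<close> by auto
    moreover have "0 \<le> \<sigma>\<^sup>2 * T" "0 \<le> \<epsilon>\<^sup>2 * T powr (2 * H)" "0 \<le> real n * \<sigma>1\<^sup>2"
      using \<open>0 < T\<close> by simp_all
    ultimately have pos: "0 < \<sigma>\<^sup>2 * T + \<epsilon>\<^sup>2 * T powr (2 * H) + real n * \<sigma>1\<^sup>2"
      by linarith
    \<comment> \<open>Up to a null set the price bound is a bound on
      \<open>logS (N T \<omega>) \<omega>\<close>, and on this event the random index equals
      \<open>n\<close>.\<close>
    have "prob (E n) = prob {\<omega> \<in> space M. N T \<omega> = n \<and> logS n \<omega> \<le> ln x - ln S0 - a}"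
      using price_iff E_meas by (intro measure_eq_AE) (auto simp: E_def)
    also have "\<dots> = prob {\<omega> \<in> space M. N T \<omega> = n} * prob {\<omega> \<in> space M. logS n \<omega> \<le> ln x - ln S0 - a}"
      \<comment> \<open>The count enters \<open>indep_N\<close> as a real number, so its event is
        the preimage of \<open>{real n}\<close>.\<close>
      using indep_varD[OF indep_N, of "{real n}" "{..ln x - ln S0 - a}" n]
      by (simp add: vimage_def Int_def conj_ac)
    also have "\<dots> = prob {\<omega> \<in> space M. N T \<omega> = n} * std_normal_cdf ((ln x - ln S0 - (a + real n * \<mu>1))
        / sqrt (\<sigma>\<^sup>2 * T + \<epsilon>\<^sup>2 * T powr (2 * H) + real n * \<sigma>1\<^sup>2))"
      by (simp only: prob_le_normal_measure[OF logS_meas logS_distr pos] diff_diff_add add.assoc)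
    finally show ?thesis
      by (simp add: N(2))
  qed

  \<comment> \<open>The events \<open>E n\<close> are disjoint and exhaust the price event, since
    \<open>N T\<close> takes exactly one natural value at each outcome; countable additivity yields
    the series.\<close>
  have "(\<lambda>n. prob (E n)) sums prob (\<Union>n. E n)"
    using E_meas by (intro finite_measure_UNION) (auto simp: disjoint_family_on_def E_def)
  also have "(\<Union>n. E n) = {\<omega> \<in> space M. terminal_price S0 r T H \<sigma> \<epsilon> W WH N J \<omega> \<le> x}"
    by (auto simp: E_def)
  finally show ?thesis
    unfolding prob_E a_def .
qed

end
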